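(* Let $V\subseteq\mathbb{R}^d$ be a (Borel measurable) cone with dual cone $V^*$, and let $w\in\mathbb{R}^d$. Then the standard Gaussian measure of the shifted cone $V+w$ satisfies $$\gamma(V)\exp\Big(-\tfrac12\|w\|^2-\mathrm{dist}(w,-V^* )\sqrt d\Big)\;\le\;\gamma(V+w)\;\le\;\gamma(V)\exp\Big(-\tfrac12\|\mathrm{proj}_{V^*}w\|^2+\mathrm{dist}(w,V^* )\sqrt d\Big).$$
   Context: A cone is a set $V\subseteq\mathbb{R}^d$ with $\alpha V=V$ for all $\alpha>0$ (not necessarily convex). Its dual is $V^*=\{y\in\mathbb{R}^d\mid y\cdot x\ge 0\ \text{for all }x\in V\}$, which is a closed convex cone. $\gamma$ is the standard Gaussian measure on $\mathbb{R}^d$, $\gamma(B)=\int_B(2\pi)^{-d/2}e^{-\|x\|^2/2}\,dx$. $\|\cdot\|$ is the Euclidean norm, $\mathrm{dist}(w,A)=\inf_{a\in A}\|w-a\|$, and $\mathrm{proj}_A w$ is the Euclidean projection of $w$ onto a closed convex set $A$. *)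

theory Defs
  imports "HOL-Analysis.Analysis"
begin

(* Differs from the library's cone, which requires closure under c >= 0, so that a
   nonempty one contains the origin. *)
definition pos_cone :: "'a::real_vector set \<Rightarrow> bool" where
  "pos_cone V \<longleftrightarrow> (\<forall>\<alpha>>0. (\<lambda>x. \<alpha> *\<^sub>R x) ` V = V)"

definition dual_cone :: "'a::real_inner set \<Rightarrow> 'a set" where
  "dual_cone V = {y. \<forall>x\<in>V. y \<bullet> x \<ge> 0}"

definition std_gaussian :: "'a::euclidean_space measure" where
  "std_gaussian = density lborel
     (\<lambda>x. ennreal ((2 * pi) powr (- real DIM('a) / 2) * exp (- (norm x)\<^sup>2 / 2)))"

end

theory Submission
  imports Defs
begin

text \<open>
  Since \<open>V\<close> is invariant under dilations, the substitution \<open>x \<mapsto> w + \<lambda> x\<close> turns the measure of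
  \<open>V + w\<close> into \<open>\<lambda>\<^sup>d\<close> times the integral over \<open>V\<close> of the Gaussian density at \<open>w + \<lambda> x\<close>, for every
  \<open>\<lambda> > 0\<close>. Each of the two bounds follows by using this for two different values of \<open>\<lambda>\<close> and comparing
  the integrands pointwise. If \<open>r\<close> is the distance in question, the optimal dilation is
  \<open>\<lambda>\<^sup>2 = 1 + r / \<surd>d\<close>, for which \<open>\<lambda>\<^sup>d \<le> exp (r \<surd>d / 2)\<close>; this is half of the error term
  \<open>r \<surd>d\<close>, and the other half comes from completing a square.
\<close>

section \<open>Cones, their duals and projection onto the dual\<close>

lemma pos_cone_scaleR_iff:
  assumes "pos_cone V" "c > 0"
  shows "c *\<^sub>R x \<in> V \<longleftrightarrow> x \<in> V"
proof
  have *: "a *\<^sub>R y \<in> V" if "a > 0" "y \<in> V" for a y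
    using assms(1) that unfolding pos_cone_def by blast
  show "c *\<^sub>R x \<in> V" if "x \<in> V" using * that assms(2) by blast
  show "x \<in> V" if "c *\<^sub>R x \<in> V"
    using *[OF _ that, of "1 / c"] assms(2) by simp
qed

lemma closed_dual_cone: "closed (dual_cone V)"
proof -
  have "dual_cone V = (\<Inter>x\<in>V. {y. y \<bullet> x \<ge> 0})"
    by (auto simp: dual_cone_def)
  then show ?thesis
    by (auto intro!: closed_Collect_le continuous_intros)
qed

lemma convex_dual_cone: "convex (dual_cone V)"
  by (auto simp: convex_def dual_cone_def inner_left_distrib)

lemma zero_in_dual_cone: "0 \<in> dual_cone V"
  by (simp add: dual_cone_def)

lemma dual_cone_nonempty: "dual_cone V \<noteq> {}"
  using zero_in_dual_cone by blast

lemma scaleR_in_dual_cone: "p \<in> dual_cone V \<Longrightarrow> c \<ge> 0 \<Longrightarrow> c *\<^sub>R p \<in> dual_cone V"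
  by (auto simp: dual_cone_def)

text \<open>The dual cone contains the ray through \<open>p\<close>, so the variational inequality
  for the closest point can be tested on both sides of \<open>p\<close>: at
  \<open>2 *\<^sub>R p\<close> and at 0. The two signs force equality.\<close>

lemma closest_point_dual_cone_orthogonal:
  fixes V :: "'a::euclidean_space set" and w :: 'a
  defines "p \<equiv> closest_point (dual_cone V) w"
  shows "(w - p) \<bullet> p = 0"
proof -
  have p: "p \<in> dual_cone V"
    unfolding p_def by (rule closest_point_in_set[OF closed_dual_cone dual_cone_nonempty])
  have *: "(w - p) \<bullet> (x - p) \<le> 0" if "x \<in> dual_cone V" for x
    unfolding p_def by (rule closest_point_dot[OF convex_dual_cone closed_dual_cone that])
  have "(w - p) \<bullet> (2 *\<^sub>R p - p) \<le> 0"
    by (intro * scaleR_in_dual_cone p) simp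
  then show ?thesis
    using *[OF zero_in_dual_cone] by (simp add: scaleR_2)
qed

section \<open>Dilating the domain of integration\<close>

lemma emeasure_std_gaussian_translate_cone:
  fixes V :: "'a::euclidean_space set"
  assumes V: "V \<in> sets borel" "pos_cone V" and c: "c > 0"
  shows "emeasure std_gaussian ((\<lambda>x. x + w) ` V) =
    ennreal (c ^ DIM('a)) * (\<integral>\<^sup>+x. ennreal ((2 * pi) powr (- real DIM('a) / 2)
      * exp (- (norm (w + c *\<^sub>R x))\<^sup>2 / 2)) * indicator V x \<partial>lborel)"
proof -
  let ?g = "\<lambda>x::'a. ennreal ((2 * pi) powr (- real DIM('a) / 2) * exp (- (norm x)\<^sup>2 / 2))"
  let ?W = "(\<lambda>x. x + w) ` V"
  have "?W = (\<lambda>y. y - w) -` V \<inter> space borel"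
    by (auto simp: image_iff) (metis diff_add_cancel)
  moreover have "(\<lambda>y. y - w) \<in> borel_measurable borel" by measurable
  ultimately have W: "?W \<in> sets borel"
    using V(1) by (metis measurable_sets)
  have [measurable]: "(indicator ?W :: 'a \<Rightarrow> ennreal) \<in> borel_measurable borel"
    using W by simp
  \<comment> \<open>Dilation invariance enters here: the domain of integration stays
    \<open>V\<close> for every \<open>c\<close>, which leaves \<open>c\<close> as a free
    parameter.\<close>
  have "w + c *\<^sub>R x \<in> ?W \<longleftrightarrow> x \<in> V" for x
    using pos_cone_scaleR_iff[OF V(2) c, of x] by (auto simp: image_iff)
  then have ind: "(indicator ?W (w + c *\<^sub>R x) :: ennreal) = indicator V x" for x
    by (simp add: indicator_def)
  have "emeasure std_gaussian ?W = (\<integral>\<^sup>+x. ?g x * indicator ?W x \<partial>lborel)"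
    unfolding std_gaussian_def using W by (subst emeasure_density) auto
  also have "\<dots> = (\<integral>\<^sup>+x. ?g x * indicator ?W x
      \<partial>density (distr lborel borel (\<lambda>x. w + c *\<^sub>R x)) (\<lambda>_. \<bar>c\<bar> ^ DIM('a)))"
    using c by (subst lborel_affine[of c w]) auto
  also have "\<dots> = (\<integral>\<^sup>+x. ennreal (c ^ DIM('a)) * (?g (w + c *\<^sub>R x) * indicator V x) \<partial>lborel)"
    using c by (simp add: nn_integral_density nn_integral_distr ind)
  also have "\<dots> = ennreal (c ^ DIM('a)) * (\<integral>\<^sup>+x. ?g (w + c *\<^sub>R x) * indicator V x \<partial>lborel)"
    using V(1) by (subst nn_integral_cmult) auto
  finally show ?thesis .
qed

text \<open>Writing one measure at scale \<open>c\<close> and the other at scale \<open>d\<close>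
  puts both integrals over the same set \<open>V\<close>, so a pointwise comparison of exponents
  suffices. The ratio of the Jacobians gives \<open>(c / d) ^ DIM('a)\<close>.\<close>

lemma emeasure_std_gaussian_translate_cone_mono:
  fixes V :: "'a::euclidean_space set"
  assumes V: "V \<in> sets borel" "pos_cone V" and c: "c > 0" and d: "d > 0"
    and le: "\<And>x. x \<in> V \<Longrightarrow> (norm (v + d *\<^sub>R x))\<^sup>2 + 2 * b \<le> (norm (w + c *\<^sub>R x))\<^sup>2"
  shows "emeasure std_gaussian ((\<lambda>x. x + w) ` V)
    \<le> ennreal ((c / d) ^ DIM('a) * exp (- b)) * emeasure std_gaussian ((\<lambda>x. x + v) ` V)"
proof -
  let ?g = "\<lambda>x::'a. ennreal ((2 * pi) powr (- real DIM('a) / 2) * exp (- (norm x)\<^sup>2 / 2))"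
  have *: "?g (w + c *\<^sub>R x) * indicator V x \<le> ennreal (exp (- b)) * (?g (v + d *\<^sub>R x) * indicator V x)"
    for x
  proof (cases "x \<in> V")
    case True
    have "exp (- (norm (w + c *\<^sub>R x))\<^sup>2 / 2) \<le> exp (- b) * exp (- (norm (v + d *\<^sub>R x))\<^sup>2 / 2)"
      using le[OF True] by (simp flip: exp_add)
    then show ?thesis
      using True by (simp add: mult.left_commute mult_left_mono flip: ennreal_mult)
  qed simp
  have "emeasure std_gaussian ((\<lambda>x. x + w) ` V)
      = ennreal (c ^ DIM('a)) * (\<integral>\<^sup>+x. ?g (w + c *\<^sub>R x) * indicator V x \<partial>lborel)"
    by (rule emeasure_std_gaussian_translate_cone[OF V c])
  also have "\<dots> \<le> ennreal (c ^ DIM('a)) *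
      (\<integral>\<^sup>+x. ennreal (exp (- b)) * (?g (v + d *\<^sub>R x) * indicator V x) \<partial>lborel)"
    using * by (intro mult_left_mono nn_integral_mono) auto
  also have "\<dots> = ennreal (c ^ DIM('a)) * (ennreal (exp (- b)) *
      (\<integral>\<^sup>+x. ?g (v + d *\<^sub>R x) * indicator V x \<partial>lborel))"
    using V(1) by (subst nn_integral_cmult) auto
  also have "\<dots> = ennreal ((c / d) ^ DIM('a) * exp (- b)) * (ennreal (d ^ DIM('a)) *
      (\<integral>\<^sup>+x. ?g (v + d *\<^sub>R x) * indicator V x \<partial>lborel))"
    using c d by (simp add: power_divide mult.assoc[symmetric] flip: ennreal_mult)
  also have "\<dots> = ennreal ((c / d) ^ DIM('a) * exp (- b)) * emeasure std_gaussian ((\<lambda>x. x + v) ` V)"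
    by (simp add: emeasure_std_gaussian_translate_cone[OF V d])
  finally show ?thesis .
qed

section \<open>Scalar inequalities for the dilation factor\<close>

lemma sqrt_one_plus_power_le_exp:
  assumes "r \<ge> 0"
  shows "sqrt (1 + r / sqrt (real n)) ^ n \<le> exp (r * sqrt (real n) / 2)"
proof -
  define u where "u = r / sqrt (real n)"
  have "u \<ge> 0" using assms by (simp add: u_def)
  have nu: "real n * u = r * sqrt (real n)"
    using real_div_sqrt[of "real n"] by (metis u_def of_nat_0_le_iff times_divide_eq_right mult.commute)
  \<comment> \<open>This is \<open>1 + u \<le> exp u\<close>, with the right side written as a
    square so that the root can be taken.\<close>
  have "1 + u \<le> exp (u / 2) ^ 2"
    by (simp flip: exp_of_nat_mult)
  then have "sqrt (1 + u) \<le> exp (u / 2)"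
    by (intro real_le_lsqrt) auto
  then have "sqrt (1 + u) ^ n \<le> exp (u / 2) ^ n"
    using \<open>u \<ge> 0\<close> by (intro power_mono) auto
  also have "\<dots> = exp (real n * u / 2)"
    by (simp flip: exp_of_nat_mult)
  finally show ?thesis
    unfolding nu by (simp only: u_def)
qed

text \<open>The weight \<open>r / s\<close> is the surplus \<open>c\<^sup>2 - 1\<close> of the
  dilation used below, so the surplus quadratic term absorbs the cross term coming from
  Cauchy-Schwarz.\<close>

lemma complete_square_weighted:
  fixes r s c y :: real
  assumes "r \<ge> 0" "s > 0"
  shows "2 * c * r * y \<le> r / s * y\<^sup>2 + c\<^sup>2 * r * s"
proof -
  have "0 \<le> r / s * (y - c * s)\<^sup>2" using assms by simp
  also have "\<dots> = r / s * y\<^sup>2 + c\<^sup>2 * r * s - 2 * c * r * y"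
    using assms by (simp add: power2_eq_square field_simps)
  finally show ?thesis by simp
qed

section \<open>The two Gaussian bounds\<close>

lemma emeasure_std_gaussian_translate_cone_upper:
  fixes V :: "'a::euclidean_space set"
  assumes V: "V \<in> sets borel" "pos_cone V"
  shows "emeasure std_gaussian ((\<lambda>x. x + w) ` V)
    \<le> ennreal (exp (- (norm (closest_point (dual_cone V) w))\<^sup>2 / 2
                  + infdist w (dual_cone V) * sqrt (real DIM('a)))) * emeasure std_gaussian V"
proof -
  define p where "p = closest_point (dual_cone V) w"
  define r where "r = norm (w - p)"
  define s where "s = sqrt (real DIM('a))"
  \<comment> \<open>With t = \<open>c\<^sup>2 - 1\<close> and n the dimension, the Jacobian costs at
    most n t / 2 in the exponent and completing the square costs \<open>r\<^sup>2\<close> / (2 t).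
    The sum is least at t = \<open>r / s\<close>, where both equal \<open>r * s / 2\<close>.\<close>
  define c where "c = sqrt (1 + r / s)"
  have s: "s > 0" by (simp add: s_def)
  have r: "r \<ge> 0" by (simp add: r_def)
  have c: "c > 0" "c\<^sup>2 = 1 + r / s" using r s by (simp_all add: c_def add_pos_nonneg)
  have p: "p \<in> dual_cone V"
    unfolding p_def by (rule closest_point_in_set[OF closed_dual_cone dual_cone_nonempty])
  have orth: "(w - p) \<bullet> p = 0"
    unfolding p_def by (rule closest_point_dual_cone_orthogonal)
  have "infdist w (dual_cone V) = setdist {w} (dual_cone V)"
    by (rule infdist_eq_setdist)
  also have "\<dots> = dist w p"
    unfolding p_def by (rule setdist_closest_point[OF closed_dual_cone dual_cone_nonempty])
  finally have dist: "infdist w (dual_cone V) = r" by (simp add: r_def dist_norm)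
  have nw: "(norm w)\<^sup>2 = (norm p)\<^sup>2 + r\<^sup>2"
    using orth by (simp add: r_def power2_norm_eq_inner inner_diff inner_commute)
  have "(norm (0 + 1 *\<^sub>R x))\<^sup>2 + 2 * ((norm p)\<^sup>2 / 2 - r * s / 2) \<le> (norm (w + c *\<^sub>R x))\<^sup>2"
    if x: "x \<in> V" for x
  proof -
    \<comment> \<open>Split \<open>w\<close> as \<open>(w - p) + p\<close>: Cauchy-Schwarz controls
      the first part, and the second pairs nonnegatively with \<open>V\<close>.\<close>
    have "- (r * norm x) \<le> (w - p) \<bullet> x"
      using Cauchy_Schwarz_ineq2[of "w - p" x] by (simp add: r_def abs_le_iff)
    moreover have "p \<bullet> x \<ge> 0" using p x by (simp add: dual_cone_def)
    ultimately have "- (r * norm x) \<le> w \<bullet> x" by (simp add: inner_diff)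
    then have "- (2 * c * r * norm x) \<le> 2 * c * (w \<bullet> x)"
      using mult_left_mono[of _ _ "2 * c"] c(1) by (fastforce simp: mult.assoc)
    \<comment> \<open>The \<open>r\<^sup>2\<close> here cancels the one in \<open>nw\<close>, so
      only \<open>r * s\<close> is lost and \<open>(norm p)\<^sup>2\<close> survives in
      full.\<close>
    moreover have "c\<^sup>2 * r * s = r * s + r\<^sup>2"
      unfolding c(2) using s by (simp add: field_simps power2_eq_square)
    then have "2 * c * r * norm x \<le> r / s * (norm x)\<^sup>2 + (r * s + r\<^sup>2)"
      using complete_square_weighted[OF r s, of c "norm x"] by (simp only:)
    moreover have "(norm (w + c *\<^sub>R x))\<^sup>2
        = (norm p)\<^sup>2 + r\<^sup>2 + 2 * c * (w \<bullet> x) + (norm x)\<^sup>2 + r / s * (norm x)\<^sup>2"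
    proof -
      have "(norm (w + c *\<^sub>R x))\<^sup>2 = (norm w)\<^sup>2 + 2 * c * (w \<bullet> x) + c\<^sup>2 * (norm x)\<^sup>2"
        unfolding power2_norm_eq_inner
        by (simp add: inner_add_left inner_add_right inner_commute[of x w] power2_eq_square
            distrib_left)
      then show ?thesis unfolding nw c(2) by (simp only: distrib_right mult_1 add.assoc)
    qed
    ultimately have "(norm x)\<^sup>2 + (norm p)\<^sup>2 - r * s \<le> (norm (w + c *\<^sub>R x))\<^sup>2"
      by linarith
    then show ?thesis by simp
  qed
  then have "emeasure std_gaussian ((\<lambda>x. x + w) ` V)
    \<le> ennreal ((c / 1) ^ DIM('a) * exp (- ((norm p)\<^sup>2 / 2 - r * s / 2)))
       * emeasure std_gaussian ((\<lambda>x. x + 0) ` V)"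
    by (rule emeasure_std_gaussian_translate_cone_mono[OF V c(1) zero_less_one])
  also have "\<dots> \<le> ennreal (exp (- (norm p)\<^sup>2 / 2 + r * s)) * emeasure std_gaussian ((\<lambda>x. x + 0) ` V)"
  proof (intro mult_right_mono ennreal_leI)
    have "c ^ DIM('a) \<le> exp (r * s / 2)"
      using sqrt_one_plus_power_le_exp[OF r] by (simp add: c_def s_def)
    then have "(c / 1) ^ DIM('a) * exp (- ((norm p)\<^sup>2 / 2 - r * s / 2))
        \<le> exp (r * s / 2) * exp (- ((norm p)\<^sup>2 / 2 - r * s / 2))"
      by simp
    also have "\<dots> = exp (- (norm p)\<^sup>2 / 2 + r * s)"
      by (simp flip: exp_add)
    finally show "(c / 1) ^ DIM('a) * exp (- ((norm p)\<^sup>2 / 2 - r * s / 2))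
        \<le> exp (- (norm p)\<^sup>2 / 2 + r * s)" .
  qed simp
  finally show ?thesis by (simp add: dist p_def s_def)
qed

text \<open>The roles are exchanged: now the unshifted cone is dilated by \<open>c\<close> and the
  translate stays at scale 1. Bounding the measure of \<open>V\<close> from above lets the same
  comparison lemma apply.\<close>

lemma emeasure_std_gaussian_translate_cone_lower:
  fixes V :: "'a::euclidean_space set"
  assumes V: "V \<in> sets borel" "pos_cone V"
  shows "emeasure std_gaussian V
    \<le> ennreal (exp ((norm w)\<^sup>2 / 2 + infdist w (uminus ` dual_cone V) * sqrt (real DIM('a))))
       * emeasure std_gaussian ((\<lambda>x. x + w) ` V)"
proof -
  define r where "r = infdist w (uminus ` dual_cone V)"
  define s where "s = sqrt (real DIM('a))"
  define c where "c = sqrt (1 + r / s)"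
  have s: "s > 0" by (simp add: s_def)
  have r: "r \<ge> 0" by (simp add: r_def infdist_nonneg)
  have c: "c > 0" "c\<^sup>2 = 1 + r / s" using r s by (simp_all add: c_def add_pos_nonneg)
  have "closed (uminus ` dual_cone V)" "uminus ` dual_cone V \<noteq> {}"
    by (simp_all add: closed_negations closed_dual_cone dual_cone_nonempty)
  then obtain q where q: "q \<in> dual_cone V" "r = dist w (- q)"
    unfolding r_def using infdist_attains_inf by blast
  have "(norm (w + 1 *\<^sub>R x))\<^sup>2 + 2 * (- (norm w)\<^sup>2 / 2 - r * s / 2) \<le> (norm (0 + c *\<^sub>R x))\<^sup>2"
    if x: "x \<in> V" for x
  proof -
    \<comment> \<open>Since \<open>- q\<close> is a nearest point to \<open>w\<close>, the norm of
      \<open>w + q\<close> is \<open>r\<close>; subtracting the nonnegative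
      \<open>q \<bullet> x\<close> then bounds \<open>w \<bullet> x\<close> from above.\<close>
    have "(w + q) \<bullet> x \<le> r * norm x"
      using norm_cauchy_schwarz[of "w + q" x] by (simp add: q(2) dist_norm)
    moreover have "q \<bullet> x \<ge> 0" using q x by (simp add: dual_cone_def)
    ultimately have "w \<bullet> x \<le> r * norm x" by (simp add: inner_add)
    \<comment> \<open>The cross term belongs to the undilated side, hence the parameter 1 in the
      square.\<close>
    moreover have "2 * r * norm x \<le> r / s * (norm x)\<^sup>2 + r * s"
      using complete_square_weighted[OF r s, of 1 "norm x"] by simp
    moreover have "(norm (w + 1 *\<^sub>R x))\<^sup>2 = (norm w)\<^sup>2 + 2 * (w \<bullet> x) + (norm x)\<^sup>2"
      by (simp add: power2_norm_eq_inner inner_add inner_commute)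
    moreover have "(norm (0 + c *\<^sub>R x))\<^sup>2 = (norm x)\<^sup>2 + r / s * (norm x)\<^sup>2"
      by (simp add: power_mult_distrib c algebra_simps)
    ultimately show ?thesis by simp
  qed
  then have "emeasure std_gaussian ((\<lambda>x. x + 0) ` V)
    \<le> ennreal ((c / 1) ^ DIM('a) * exp (- (- (norm w)\<^sup>2 / 2 - r * s / 2)))
       * emeasure std_gaussian ((\<lambda>x. x + w) ` V)"
    by (rule emeasure_std_gaussian_translate_cone_mono[OF V c(1) zero_less_one])
  also have "\<dots> \<le> ennreal (exp ((norm w)\<^sup>2 / 2 + r * s)) * emeasure std_gaussian ((\<lambda>x. x + w) ` V)"
  proof (intro mult_right_mono ennreal_leI)
    have "c ^ DIM('a) \<le> exp (r * s / 2)"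
      using sqrt_one_plus_power_le_exp[OF r] by (simp add: c_def s_def)
    then have "(c / 1) ^ DIM('a) * exp (- (- (norm w)\<^sup>2 / 2 - r * s / 2))
        \<le> exp (r * s / 2) * exp (- (- (norm w)\<^sup>2 / 2 - r * s / 2))"
      by simp
    also have "\<dots> = exp ((norm w)\<^sup>2 / 2 + r * s)"
      by (simp flip: exp_add)
    finally show "(c / 1) ^ DIM('a) * exp (- (- (norm w)\<^sup>2 / 2 - r * s / 2))
        \<le> exp ((norm w)\<^sup>2 / 2 + r * s)" .
  qed simp
  finally show ?thesis by (simp add: r_def s_def)
qed

text \<open>The second hypothesis excludes that only \<open>B\<close> is infinite, where \<open>enn2real B\<close> would be 0;
  so the finiteness of the Gaussian measure is never needed.\<close>

lemma enn2real_le_mult: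
  assumes "A \<le> ennreal c * B" "B \<le> ennreal c' * A" "c \<ge> 0"
  shows "enn2real A \<le> c * enn2real B"
proof (cases "B = top")
  case True
  then have "A = top"
    using assms(2) by (auto simp: top_unique ennreal_mult_eq_top_iff)
  then show ?thesis using True by simp
next
  case False
  then have "enn2real A \<le> enn2real (ennreal c * B)"
    using assms(1) by (intro enn2real_mono) (auto simp: ennreal_mult_less_top top.not_eq_extremum)
  then show ?thesis using assms(3) by (simp add: enn2real_mult)
qed

theorem theorem1p3:
  fixes V :: "'a::euclidean_space set" and w :: 'a
  assumes "V \<in> sets borel"
    and "pos_cone V"
  shows "measure std_gaussian V
           * exp (- (norm w)\<^sup>2 / 2 - infdist w (uminus ` dual_cone V) * sqrt (real DIM('a)))
         \<le> measure std_gaussian ((\<lambda>x. x + w) ` V)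
       \<and> measure std_gaussian ((\<lambda>x. x + w) ` V)
         \<le> measure std_gaussian V
           * exp (- (norm (closest_point (dual_cone V) w))\<^sup>2 / 2
                  + infdist w (dual_cone V) * sqrt (real DIM('a)))"
proof
  note upper = emeasure_std_gaussian_translate_cone_upper[OF assms, of w]
  note lower = emeasure_std_gaussian_translate_cone_lower[OF assms, of w]
  let ?e = "(norm w)\<^sup>2 / 2 + infdist w (uminus ` dual_cone V) * sqrt (real DIM('a))"
  \<comment> \<open>Each of the two bounds supplies the reverse hypothesis for converting the other
    to real numbers.\<close>
  have "measure std_gaussian V \<le> exp ?e * measure std_gaussian ((\<lambda>x. x + w) ` V)"
    unfolding measure_def by (rule enn2real_le_mult[OF lower upper]) simp
  then have "measure std_gaussian V * exp (- ?e) \<le> measure std_gaussian ((\<lambda>x. x + w) ` V)"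
    by (simp add: exp_minus field_simps)
  then show "measure std_gaussian V
           * exp (- (norm w)\<^sup>2 / 2 - infdist w (uminus ` dual_cone V) * sqrt (real DIM('a)))
         \<le> measure std_gaussian ((\<lambda>x. x + w) ` V)"
    by simp
  show "measure std_gaussian ((\<lambda>x. x + w) ` V)
         \<le> measure std_gaussian V
           * exp (- (norm (closest_point (dual_cone V) w))\<^sup>2 / 2
                  + infdist w (dual_cone V) * sqrt (real DIM('a)))"
    unfolding measure_def using enn2real_le_mult[OF upper lower] by (simp add: mult.commute)
qed

end
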